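(* Let $F$ be an algebraically closed field of characteristic zero. Every nontrivial Rota--Baxter operator of weight $1$ on $M_2(F)$, up to conjugation with an automorphism of $M_2(F)$ or transpose and up to the action of $\phi$, equals one of the following, where $x=\begin{pmatrix}x_{11}&x_{12}\\ x_{21}&x_{22}\end{pmatrix}$: (M1) $R(x)=\begin{pmatrix}0&-x_{12}\\ 0&x_{11}\end{pmatrix}$, (M2) $R(x)=\begin{pmatrix}-x_{11}&-x_{12}\\ 0&0\end{pmatrix}$, (M3) $R(x)=\begin{pmatrix}0&0\\ -x_{21}&0\end{pmatrix}$, (M4) $R(x)=\begin{pmatrix}x_{21}&0\\ -x_{21}&0\end{pmatrix}$, (M5) $R(x)=\begin{pmatrix}x_{12}&-x_{12}\\ -x_{21}&x_{21}\end{pmatrix}$, (M6) $R(x)=\begin{pmatrix}x_{22}-x_{11}&-x_{12}\\ 0&0\end{pmatrix}$. Moreover, these 6 cases lie in different orbits of the set of Rota--Baxter operators of weight $1$ on $M_2(F)$ under the action of $\phi$ and conjugation with $\mathrm{Aut}(M_2(F))$ or transpose.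
   Context: Given an associative algebra $A$ over a field $F$ and $\lambda\in F$, a linear operator $R\colon A\to A$ is a Rota--Baxter operator of weight $\lambda$ if $R(x)R(y)=R(R(x)y+xR(y)+\lambda xy)$ for all $x,y\in A$. An RB-operator of weight $1$ is called nontrivial if it is neither $0$ nor $-\mathrm{id}$. For an RB-operator $R$ of weight $1$, $\phi(R)=-(R+\mathrm{id})$ is again an RB-operator of weight $1$; conjugation with an algebra automorphism $\psi$ is $R\mapsto\psi^{-1}R\psi$; conjugation with transpose $T$ is $R\mapsto TRT$. Orbits are taken under the group generated by $\phi$, all conjugations with automorphisms of $M_2(F)$, and conjugation with transpose; "up to" these actions means some operator in the orbit is on the list. *)

theory Defs
  imports "HOL-Analysis.Analysis" "HOL-Algebra.Bij" "HOL-Algebra.Generated_Groups"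
    "HOL-Algebra.Group_Action"
begin

definition rota_baxter ::
    "('f::field \<Rightarrow> 'a::ab_group_add \<Rightarrow> 'a) \<Rightarrow> ('a \<Rightarrow> 'a \<Rightarrow> 'a) \<Rightarrow> 'f \<Rightarrow> ('a \<Rightarrow> 'a) \<Rightarrow> bool" where
  "rota_baxter scl mul l R \<longleftrightarrow>
     Vector_Spaces.linear scl scl R \<and>
     (\<forall>x y. mul (R x) (R y) = R (mul (R x) y + mul x (R y) + scl l (mul x y)))"

definition algebra_automorphism ::
    "('f::field \<Rightarrow> 'a::ab_group_add \<Rightarrow> 'a) \<Rightarrow> ('a \<Rightarrow> 'a \<Rightarrow> 'a) \<Rightarrow> ('a \<Rightarrow> 'a) \<Rightarrow> bool" where
  "algebra_automorphism scl mul \<psi> \<longleftrightarrow>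
     Vector_Spaces.linear scl scl \<psi> \<and> bij \<psi> \<and> (\<forall>x y. \<psi> (mul x y) = mul (\<psi> x) (\<psi> y))"

type_synonym 'f m2 = "'f^2^2"

definition mscale :: "'f::field \<Rightarrow> 'f m2 \<Rightarrow> 'f m2" where
  "mscale c = map_matrix ((*) c)"

definition mat22 :: "'f::field \<Rightarrow> 'f \<Rightarrow> 'f \<Rightarrow> 'f \<Rightarrow> 'f m2" where
  "mat22 a b c d = vector [vector [a, b], vector [c, d]]"

abbreviation is_RB1 :: "('f::field m2 \<Rightarrow> 'f m2) \<Rightarrow> bool" where
  "is_RB1 \<equiv> rota_baxter mscale (**) 1"

definition nontrivial_RB1 :: "('f::field m2 \<Rightarrow> 'f m2) \<Rightarrow> bool" where
  "nontrivial_RB1 R \<longleftrightarrow> is_RB1 R \<and> R \<noteq> (\<lambda>x. 0) \<and> R \<noteq> (\<lambda>x. - x)"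

definition rb_phi :: "('f::field m2 \<Rightarrow> 'f m2) \<Rightarrow> ('f m2 \<Rightarrow> 'f m2)" where
  "rb_phi R = (\<lambda>x. - (R x + x))"

definition conj_by :: "('f::field m2 \<Rightarrow> 'f m2) \<Rightarrow> ('f m2 \<Rightarrow> 'f m2) \<Rightarrow> ('f m2 \<Rightarrow> 'f m2)" where
  "conj_by \<psi> R = inv_into UNIV \<psi> \<circ> R \<circ> \<psi>"

definition conj_transpose :: "('f::field m2 \<Rightarrow> 'f m2) \<Rightarrow> ('f m2 \<Rightarrow> 'f m2)" where
  "conj_transpose R = transpose \<circ> R \<circ> transpose"

definition rb_generators :: "(('f::field m2 \<Rightarrow> 'f m2) \<Rightarrow> ('f m2 \<Rightarrow> 'f m2)) set" where
  "rb_generators =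
     {rb_phi, conj_transpose} \<union> {conj_by \<psi> | \<psi>. algebra_automorphism mscale (**) \<psi>}"

text \<open>The group is realised inside the permutations of all maps on matrices, so that its
  elements are ordinary total functions. The lemmas below show that the generators are such
  permutations and map Rota--Baxter operators of weight 1 to Rota--Baxter operators of weight 1;
  hence orbits of Rota--Baxter operators consist of Rota--Baxter operators.\<close>

definition rb_group :: "(('f::field m2 \<Rightarrow> 'f m2) \<Rightarrow> ('f m2 \<Rightarrow> 'f m2)) monoid" where
  "rb_group = subgroup_generated (BijGroup UNIV) rb_generators"

definition rb_orbit :: "('f::field m2 \<Rightarrow> 'f m2) \<Rightarrow> ('f m2 \<Rightarrow> 'f m2) set" where
  "rb_orbit R = orbit rb_group (\<lambda>g. g) R"

definition RB_M1 :: "'f::field m2 \<Rightarrow> 'f m2" where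
  "RB_M1 x = mat22 0 (- x$1$2) 0 (x$1$1)"

definition RB_M2 :: "'f::field m2 \<Rightarrow> 'f m2" where
  "RB_M2 x = mat22 (- x$1$1) (- x$1$2) 0 0"

definition RB_M3 :: "'f::field m2 \<Rightarrow> 'f m2" where
  "RB_M3 x = mat22 0 0 (- x$2$1) 0"

definition RB_M4 :: "'f::field m2 \<Rightarrow> 'f m2" where
  "RB_M4 x = mat22 (x$2$1) 0 (- x$2$1) 0"

definition RB_M5 :: "'f::field m2 \<Rightarrow> 'f m2" where
  "RB_M5 x = mat22 (x$1$2) (- x$1$2) (- x$2$1) (x$2$1)"

definition RB_M6 :: "'f::field m2 \<Rightarrow> 'f m2" where
  "RB_M6 x = mat22 (x$2$2 - x$1$1) (- x$1$2) 0 0"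

text \<open>A list rather than a set, so that distinctness statements are not collapsed by
  accidental equalities between entries.\<close>

definition RB_list :: "('f::field m2 \<Rightarrow> 'f m2) list" where
  "RB_list = [RB_M1, RB_M2, RB_M3, RB_M4, RB_M5, RB_M6]"

lemma vector_space_mscale: "vector_space (mscale :: 'f::field \<Rightarrow> _)"
  by unfold_locales (simp_all add: mscale_def vec_eq_iff algebra_simps)

lemma mscale_one [simp]: "mscale 1 A = A"
  by (simp add: mscale_def vec_eq_iff)

lemma linear_mscale_iff:
  "Vector_Spaces.linear mscale mscale R \<longleftrightarrow>
     (\<forall>x y. R (x + y) = R x + R y) \<and> (\<forall>c x. R (mscale c x) = mscale c (R x))"
  by (auto simp: Vector_Spaces.linear_iff vector_space_mscale)

lemma bij_rb_phi: "bij rb_phi"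
proof (rule o_bij)
  show "rb_phi \<circ> rb_phi = id" "rb_phi \<circ> rb_phi = id"
    by (simp_all add: rb_phi_def fun_eq_iff)
qed

lemma bij_conj_transpose: "bij conj_transpose"
proof (rule o_bij)
  show "conj_transpose \<circ> conj_transpose = id" "conj_transpose \<circ> conj_transpose = id"
    by (simp_all add: conj_transpose_def fun_eq_iff)
qed

lemma bij_conj_by:
  assumes "bij \<psi>" shows "bij (conj_by \<psi>)"
proof (rule o_bij)
  let ?g = "\<lambda>R. \<psi> \<circ> R \<circ> inv_into UNIV \<psi>"
  show "?g \<circ> conj_by \<psi> = id" "conj_by \<psi> \<circ> ?g = id"
    using assms
    by (simp_all add: conj_by_def fun_eq_iff bij_is_surj bij_is_inj surj_f_inv_f inv_f_f)
qed

lemma rb_generators_Bij: "rb_generators \<subseteq> carrier (BijGroup UNIV)"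
  by (auto simp: rb_generators_def BijGroup_def Bij_def algebra_automorphism_def
      bij_rb_phi bij_conj_transpose bij_conj_by)

lemma carrier_rb_group: "carrier rb_group = generate (BijGroup UNIV) rb_generators"
  unfolding rb_group_def carrier_subgroup_generated
  by (simp only: Int_absorb1[OF rb_generators_Bij])

lemma is_RB1_rb_phi:
  assumes "is_RB1 R" shows "is_RB1 (rb_phi R)"
proof -
  have add: "R (x + y) = R x + R y" and scl: "R (mscale c x) = mscale c (R x)" for x y c
    using assms by (auto simp: rota_baxter_def linear_mscale_iff)
  have mul: "R x ** R y = R (R x ** y) + R (x ** R y) + R (x ** y)" for x y
    using assms by (simp add: rota_baxter_def add)
  have neg: "R (- x) = - R x" for x
    using add[of x "- x"] add[of 0 0] by (simp add: eq_neg_iff_add_eq_0 add.commute)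
  have sub: "R (x - y) = R x - R y" for x y
    using add[of x "- y"] by (simp add: neg)
  have mneg: "(- x) ** y = - (x ** y)" "x ** (- y) = - (x ** y)" for x y :: "'a m2"
    by (simp_all add: matrix_matrix_mult_def vec_eq_iff sum_negf)
  have radd: "(x + y) ** z = x ** z + y ** z" for x y z :: "'a m2"
    by (simp add: matrix_matrix_mult_def vec_eq_iff sum.distrib algebra_simps)
  have mscl: "mscale c (x + y) = mscale c x + mscale c y" "mscale c (- x) = - mscale c x"
    for c and x y :: "'a m2"
    by (simp_all add: mscale_def vec_eq_iff algebra_simps)
  show ?thesis
    unfolding rota_baxter_def linear_mscale_iff rb_phi_def
    by (simp add: add scl neg mneg mul mscl matrix_add_ldistrib radd sub
        del: minus_add_distrib)
qed

lemma is_RB1_conj_transpose: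
  assumes "is_RB1 R" shows "is_RB1 (conj_transpose R)"
proof -
  have tadd: "transpose (x + y) = transpose x + transpose y"
    and tscl: "transpose (mscale c x) = mscale c (transpose x)" for x y :: "'a m2" and c
    by (simp_all add: transpose_def mscale_def vec_eq_iff)
  have mul: "R x ** R y = R (R x ** y + x ** R y + x ** y)" for x y
    using assms by (simp add: rota_baxter_def)
  have "transpose (R (transpose x)) ** transpose (R (transpose y)) =
      transpose (R (transpose (transpose (R (transpose x)) ** y +
        x ** transpose (R (transpose y)) + x ** y)))" for x y
    by (simp add: tadd matrix_transpose_mul mul ac_simps flip: matrix_transpose_mul[of "R _" "R _"])
  then show ?thesis
    using assms unfolding rota_baxter_def linear_mscale_iff conj_transpose_def
    by (simp add: tadd tscl)
qed

lemma is_RB1_conj_by: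
  assumes "is_RB1 R" "algebra_automorphism mscale (**) \<psi>" shows "is_RB1 (conj_by \<psi> R)"
proof -
  let ?i = "inv_into UNIV \<psi>"
  have b: "bij \<psi>" and add: "\<psi> (x + y) = \<psi> x + \<psi> y" and scl: "\<psi> (mscale c x) = mscale c (\<psi> x)"
    and mul: "\<psi> (x ** y) = \<psi> x ** \<psi> y" for x y c
    using assms by (auto simp: algebra_automorphism_def linear_mscale_iff)
  have fi: "\<psi> (?i x) = x" for x
    using b by (simp add: bij_is_surj surj_f_inv_f)
  have inj: "x = y \<longleftrightarrow> \<psi> x = \<psi> y" for x y
    using b by (simp add: bij_is_inj inj_eq)
  show ?thesis
    using assms(1) unfolding rota_baxter_def linear_mscale_iff conj_by_def
    by (auto simp: inj[of "?i _"] inj[of "?i _ ** _"] fi add scl mul)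
qed

end

theory Submission
  imports Defs
begin

text \<open>Put a = R 1. Then 2 R a = a (a - 1), and applying R to the Cayley--Hamilton equation of a shows
  that a is 0, - 1 or diagonalisable with spectrum {0, - 1}, {0, 1} or {- 1, - 2}. Up to phi and
  conjugation a is therefore the matrix unit e22, - e11 or 0. The first two cases determine R up to
  transpose and give (M1) and (M2).
  If a = 0 then R (R x) = - R x, and the image of R is a subalgebra of singular matrices. After a
  conjugation it contains e11 or e12, and then, up to transpose, it lies in the first row. This
  leaves three explicit families, conjugate to (M3), (M4) and to (M5) or (M6).
  The orbits are separated by invariants of the following kind: whether R R = - R, whether R 1 is a
  scalar, and, if so, whether suitable eigenspaces of R contain nilpotents or idempotents.\<close>

section \<open>Entrywise calculus for 2 by 2 matrices\<close>

lemma mat22_sel [simp]: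
  "mat22 a b c d $ 1 $ 1 = a" "mat22 a b c d $ 1 $ 2 = b"
  "mat22 a b c d $ 2 $ 1 = c" "mat22 a b c d $ 2 $ 2 = d"
  by (simp_all add: mat22_def)

lemma m2_eq_iff:
  "x = y \<longleftrightarrow> x$1$1 = y$1$1 \<and> x$1$2 = y$1$2 \<and> x$2$1 = y$2$1 \<and> x$2$2 = y$2$2"
  for x y :: "'f::field m2"
  by (auto simp: vec_eq_iff forall_2)

lemma mat22_cases:
  fixes x :: "'f::field m2"
  obtains a b c d where "x = mat22 a b c d"
  by (rule that[of "x$1$1" "x$1$2" "x$2$1" "x$2$2"]) (simp add: m2_eq_iff)

lemma mat22_eq_iff [simp]:
  "mat22 a b c d = mat22 a' b' c' d' \<longleftrightarrow> a = a' \<and> b = b' \<and> c = c' \<and> d = d'"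
  by (simp add: m2_eq_iff)

lemma m2_sel [simp]:
  "(x ** y) $ i $ j = x$i$1 * y$1$j + x$i$2 * y$2$j"
  "mscale r x $ i $ j = r * x$i$j"
  "transpose x $ i $ j = x $ j $ i"
  "(mat r :: 'f m2) $ 1 $ 1 = r" "(mat r :: 'f m2) $ 1 $ 2 = 0"
  "(mat r :: 'f m2) $ 2 $ 1 = 0" "(mat r :: 'f m2) $ 2 $ 2 = r"
  for x y :: "'f::field m2"
  by (simp_all add: matrix_matrix_mult_def sum_2 mscale_def transpose_def mat_def)

lemma mat22_simps [simp]:
  fixes a b c d :: "'f::field"
  shows "mat22 a b c d + mat22 a' b' c' d' = mat22 (a + a') (b + b') (c + c') (d + d')"
    "mat22 a b c d - mat22 a' b' c' d' = mat22 (a - a') (b - b') (c - c') (d - d')"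
    "- mat22 a b c d = mat22 (- a) (- b) (- c) (- d)"
    "mscale r (mat22 a b c d) = mat22 (r * a) (r * b) (r * c) (r * d)"
    "transpose (mat22 a b c d) = mat22 a c b d"
    "mat22 a b c d ** mat22 a' b' c' d' =
       mat22 (a * a' + b * c') (a * b' + b * d') (c * a' + d * c') (c * b' + d * d')"
  by (simp_all add: m2_eq_iff)

lemma mat22_zero: "(0 :: 'f::field m2) = mat22 0 0 0 0"
  and mat22_one: "(mat 1 :: 'f m2) = mat22 1 0 0 1"
  by (simp_all add: m2_eq_iff)

section \<open>First consequences of the Rota--Baxter identity\<close>

context
  fixes R :: "'f::field m2 \<Rightarrow> 'f m2"
  assumes rb: "is_RB1 R"
begin

lemma RB1_add: "R (x + y) = R x + R y"
  and RB1_mscale: "R (mscale c x) = mscale c (R x)"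
  using rb by (auto simp: rota_baxter_def linear_mscale_iff)

lemma RB1_mult: "R x ** R y = R (R x ** y) + R (x ** R y) + R (x ** y)"
  using rb by (simp add: rota_baxter_def RB1_add)

lemma RB1_zero: "R 0 = 0"
  using RB1_add[of 0 0] by simp

lemma RB1_minus: "R (- x) = - R x"
  using RB1_add[of x "- x"] by (simp add: RB1_zero eq_neg_iff_add_eq_0 add.commute)

lemma RB1_expand:
  "R x = mscale (x$1$1) (R (mat22 1 0 0 0)) + mscale (x$1$2) (R (mat22 0 1 0 0)) +
         mscale (x$2$1) (R (mat22 0 0 1 0)) + mscale (x$2$2) (R (mat22 0 0 0 1))"
proof -
  have "x = mscale (x$1$1) (mat22 1 0 0 0) + mscale (x$1$2) (mat22 0 1 0 0) +
            mscale (x$2$1) (mat22 0 0 1 0) + mscale (x$2$2) (mat22 0 0 0 1)"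
    by (simp add: m2_eq_iff)
  then show ?thesis
    by (metis RB1_add RB1_mscale)
qed

end

lemma RB_list_RB1: "\<forall>M \<in> set (RB_list :: ('f::field m2 \<Rightarrow> 'f m2) list). is_RB1 M"
  by (auto simp: RB_list_def rota_baxter_def linear_mscale_iff RB_M1_def RB_M2_def RB_M3_def
      RB_M4_def RB_M5_def RB_M6_def m2_eq_iff algebra_simps)

subsection \<open>Orbits\<close>

text \<open>Inner automorphisms are given by a matrix and an explicit inverse, so that the inverse
  map has a closed formula as well.\<close>

lemma algebra_automorphism_inner:
  assumes "P ** Q = mat 1" "Q ** P = mat 1"
  shows "algebra_automorphism mscale (**) (\<lambda>x :: 'f::field m2. Q ** x ** P)"
    and "inv_into UNIV (\<lambda>x :: 'f::field m2. Q ** x ** P) = (\<lambda>x. P ** x ** Q)"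
proof -
  have 1: "P ** (Q ** x ** P) ** Q = x" "Q ** (P ** x ** Q) ** P = x" for x
    by (metis assms matrix_mul_assoc matrix_mul_lid matrix_mul_rid)+
  have b: "bij (\<lambda>x. Q ** x ** P)"
    by (rule o_bij[where g = "\<lambda>x. P ** x ** Q"]) (simp_all add: fun_eq_iff 1)
  have "Q ** (x ** y) ** P = (Q ** x ** P) ** (Q ** y ** P)" for x y
    by (metis assms(1) matrix_mul_assoc matrix_mul_lid)
  moreover have "Q ** (x + y) ** P = Q ** x ** P + Q ** y ** P" for x y
    by (simp add: m2_eq_iff algebra_simps)
  moreover have "Q ** mscale c x ** P = mscale c (Q ** x ** P)" for x c
    by (simp add: m2_eq_iff algebra_simps)
  ultimately show "algebra_automorphism mscale (**) (\<lambda>x. Q ** x ** P)"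
    using b by (simp add: algebra_automorphism_def linear_mscale_iff)
  show "inv_into UNIV (\<lambda>x. Q ** x ** P) = (\<lambda>x. P ** x ** Q)"
    by (rule inv_equality) (simp_all add: 1)
qed

lemma algebra_automorphism_inv:
  assumes "algebra_automorphism mscale (**) (\<psi> :: 'f::field m2 \<Rightarrow> 'f m2)"
  shows "algebra_automorphism mscale (**) (inv_into UNIV \<psi>)"
proof -
  have b: "bij \<psi>" and "\<psi> (x + y) = \<psi> x + \<psi> y" "\<psi> (mscale c x) = mscale c (\<psi> x)"
    and "\<psi> (x ** y) = \<psi> x ** \<psi> y" for x y c
    using assms by (auto simp: algebra_automorphism_def linear_mscale_iff)
  moreover have "\<psi> (inv_into UNIV \<psi> x) = x" "inv_into UNIV \<psi> (\<psi> x) = x" for x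
    using b by (simp_all add: bij_is_surj surj_f_inv_f bij_is_inj)
  ultimately show ?thesis
    unfolding algebra_automorphism_def linear_mscale_iff
    by (metis bij_imp_bij_inv)
qed

text \<open>\<open>rb_phi\<close> and \<open>conj_transpose\<close> are involutions, and conjugation
  with \<psi> is undone by conjugation with the inverse of \<psi>. This settles the inverse case of
  inductions over the generated group.\<close>

lemma inv_rb_generators:
  assumes "g \<in> rb_generators"
  shows "inv\<^bsub>BijGroup UNIV\<^esub> g \<in> rb_generators"
proof -
  have "inv\<^bsub>BijGroup UNIV\<^esub> g = inv_into UNIV g"
    using assms rb_generators_Bij by (subst inv_BijGroup) (auto simp: BijGroup_def)
  moreover have "inv_into UNIV (rb_phi :: ('f::field m2 \<Rightarrow> _) \<Rightarrow> _) = rb_phi"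
    by (rule inv_equality) (simp_all add: rb_phi_def)
  moreover have "inv_into UNIV (conj_transpose :: ('f::field m2 \<Rightarrow> _) \<Rightarrow> _) = conj_transpose"
    by (rule inv_equality) (simp_all add: conj_transpose_def fun_eq_iff)
  moreover have "inv_into UNIV (conj_by \<psi>) = conj_by (inv_into UNIV \<psi>)"
    if "bij \<psi>" for \<psi> :: "'f::field m2 \<Rightarrow> 'f m2"
    by (rule inv_equality)
      (simp_all add: conj_by_def fun_eq_iff that inv_inv_eq bij_is_surj surj_f_inv_f bij_is_inj)
  moreover have "bij \<psi>" if "algebra_automorphism mscale (**) \<psi>" for \<psi> :: "'f::field m2 \<Rightarrow> 'f m2"
    using that by (simp add: algebra_automorphism_def)
  ultimately show ?thesis
    using assms algebra_automorphism_inv unfolding rb_generators_def by fastforce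
qed

lemma rb_orbit_eq: "rb_orbit R = {g R | g. g \<in> generate (BijGroup UNIV) rb_generators}"
  by (simp add: rb_orbit_def orbit_def carrier_rb_group)

lemma rb_orbitI: "g \<in> generate (BijGroup UNIV) rb_generators \<Longrightarrow> g R \<in> rb_orbit R"
  unfolding rb_orbit_eq by (rule CollectI, rule exI[of _ g]) simp

lemma rb_orbitE:
  assumes "S \<in> rb_orbit R"
  obtains g where "g \<in> generate (BijGroup UNIV) rb_generators" "S = g R"
  using assms unfolding rb_orbit_eq mem_Collect_eq by (elim exE conjE)

lemma rb_orbit_refl: "R \<in> rb_orbit R"
proof -
  have "\<one>\<^bsub>BijGroup UNIV\<^esub> R = R"
    by (simp add: BijGroup_def)
  then show ?thesis
    using rb_orbitI[OF generate.one, of R] by simp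
qed

lemma BijGroup_UNIV_mult:
  "\<lbrakk>g \<in> carrier (BijGroup UNIV); h \<in> carrier (BijGroup UNIV)\<rbrakk> \<Longrightarrow>
    g \<otimes>\<^bsub>BijGroup UNIV\<^esub> h = g \<circ> h"
  by (auto simp: BijGroup_def compose_def)

lemma generate_rb_Bij:
  "g \<in> generate (BijGroup UNIV) rb_generators \<Longrightarrow> g \<in> carrier (BijGroup UNIV)"
  using group.generate_in_carrier[OF group_BijGroup rb_generators_Bij] .

text \<open>Right multiplication by g turns a group element applied to \<open>g R\<close> into one
  applied to \<open>R\<close>. This is what permits replacing an operator by a normalised
  one.\<close>

lemma rb_orbit_step:
  assumes "g \<in> rb_generators" "M \<in> rb_orbit (g R)"
  shows "M \<in> rb_orbit R"
proof -
  obtain h where h: "h \<in> generate (BijGroup UNIV) rb_generators" "M = h (g R)"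
    using rb_orbitE[OF assms(2)] .
  have "h \<otimes>\<^bsub>BijGroup UNIV\<^esub> g \<in> generate (BijGroup UNIV) rb_generators"
    using assms(1) h(1) by (simp add: generate.eng generate.incl)
  moreover have "h \<otimes>\<^bsub>BijGroup UNIV\<^esub> g = h \<circ> g"
    using assms(1) h(1) generate_rb_Bij rb_generators_Bij by (blast intro: BijGroup_UNIV_mult)
  ultimately show ?thesis
    using h(2) rb_orbitI[of "h \<circ> g" R] by simp
qed

text \<open>Induction over the generated group; since inverses of generators are generators,
  preservation in one direction is enough.\<close>

lemma rb_orbit_invariant:
  assumes "S \<in> rb_orbit R" "X R"
    and gen: "\<And>g R. \<lbrakk>g \<in> rb_generators; X R\<rbrakk> \<Longrightarrow> X (g R)"
  shows "X S"
proof -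
  have "\<forall>R. X R \<longrightarrow> X (g R)" if "g \<in> generate (BijGroup UNIV) rb_generators" for g
    using that
  proof (induction rule: generate.induct)
    case one
    show ?case by (simp add: BijGroup_def)
  next
    case (incl h)
    then show ?case using gen by simp
  next
    case (inv h)
    then show ?case using gen[OF inv_rb_generators] by simp
  next
    case (eng h1 h2)
    then show ?case by (simp add: BijGroup_UNIV_mult generate_rb_Bij)
  qed
  moreover obtain g where "g \<in> generate (BijGroup UNIV) rb_generators" "S = g R"
    using rb_orbitE[OF assms(1)] .
  ultimately show ?thesis
    using assms(2) by simp
qed

definition RB_listed :: "('f::field m2 \<Rightarrow> 'f m2) \<Rightarrow> bool" where
  "RB_listed R \<longleftrightarrow> (\<exists>M \<in> set RB_list. M \<in> rb_orbit R)"

lemma RB_listedI: "R \<in> set RB_list \<Longrightarrow> RB_listed R"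
  unfolding RB_listed_def using rb_orbit_refl by blast

lemma RB_listed_generator: "\<lbrakk>g \<in> rb_generators; RB_listed (g R)\<rbrakk> \<Longrightarrow> RB_listed R"
  unfolding RB_listed_def using rb_orbit_step by blast

lemma RB_listed_phi: "RB_listed (rb_phi R) \<Longrightarrow> RB_listed R"
  by (rule RB_listed_generator[of rb_phi]) (simp_all add: rb_generators_def)

lemma RB_listed_transpose: "RB_listed (conj_transpose R) \<Longrightarrow> RB_listed R"
  by (rule RB_listed_generator[of conj_transpose]) (simp_all add: rb_generators_def)

text \<open>For mutually inverse \<open>P\<close> and \<open>Q\<close> this is conjugation with the
  inner automorphism that takes x to \<open>Q ** x ** P\<close>. Written with two matrices it can be
  computed entry by entry.\<close>

definition conj_mat :: "'f::field m2 \<Rightarrow> 'f m2 \<Rightarrow> ('f m2 \<Rightarrow> 'f m2) \<Rightarrow> ('f m2 \<Rightarrow> 'f m2)" where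
  "conj_mat P Q R = (\<lambda>x. P ** R (Q ** x ** P) ** Q)"

lemma conj_mat_eq_conj_by:
  assumes "P ** Q = mat 1" "Q ** P = mat 1"
  shows "conj_mat P Q R = conj_by (\<lambda>x. Q ** x ** P) R"
  by (simp add: conj_mat_def conj_by_def algebra_automorphism_inner[OF assms] fun_eq_iff)

lemma RB_listed_conj_mat:
  assumes "P ** Q = mat 1" "Q ** P = mat 1" "RB_listed (conj_mat P Q R)"
  shows "RB_listed R"
proof (rule RB_listed_generator)
  show "conj_by (\<lambda>x. Q ** x ** P) \<in> rb_generators"
    using algebra_automorphism_inner[OF assms(1,2)] by (auto simp: rb_generators_def)
  show "RB_listed (conj_by (\<lambda>x. Q ** x ** P) R)"
    using assms by (simp add: conj_mat_eq_conj_by)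
qed

lemma is_RB1_conj_mat:
  assumes "P ** Q = mat 1" "Q ** P = mat 1" "is_RB1 R"
  shows "is_RB1 (conj_mat P Q R)"
  using assms by (simp add: conj_mat_eq_conj_by is_RB1_conj_by algebra_automorphism_inner)

text \<open>Arguments and values are conjugated by the same matrix. Hence the value at 1 and
  eigenvectors of \<open>R\<close> can be brought to normal form by similarity.\<close>

lemma conj_mat_apply:
  assumes "P ** Q = mat 1" "Q ** P = mat 1"
  shows "conj_mat P Q R (P ** x ** Q) = P ** R x ** Q"
proof -
  have "Q ** (P ** x ** Q) ** P = x"
    by (metis assms matrix_mul_assoc matrix_mul_lid matrix_mul_rid)
  then show ?thesis by (simp add: conj_mat_def)
qed

lemma conj_mat_one:
  assumes "P ** Q = mat 1" "Q ** P = mat 1"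
  shows "conj_mat P Q R (mat 1) = P ** R (mat 1) ** Q"
  using conj_mat_apply[OF assms, of R "mat 1"] assms by simp

subsection \<open>Similarity of 2 by 2 matrices\<close>

text \<open>A nonscalar matrix has a cyclic vector, and in the basis of that vector and its image it
  becomes the companion matrix of its characteristic polynomial. The vector is e1, e2 or e1 + e2 in
  the three cases.\<close>

lemma similar_companion:
  fixes a :: "'f::field m2"
  assumes "\<not> (a$1$2 = 0 \<and> a$2$1 = 0 \<and> a$1$1 = a$2$2)"
  obtains P Q where "P ** Q = mat 1" "Q ** P = mat 1"
    "P ** a ** Q = mat22 0 (a$1$2 * a$2$1 - a$1$1 * a$2$2) 1 (a$1$1 + a$2$2)"
proof -
  obtain p q r s where a: "a = mat22 p q r s" by (rule mat22_cases)
  text \<open>The columns of Q are a vector and its image under a.\<close>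
  consider "r \<noteq> 0" | "r = 0" "q \<noteq> 0" | "r = 0" "q = 0" "p \<noteq> s"
    using assms a by auto
  then show thesis
  proof cases
    case 1
    then show thesis
      by (intro that[of "mat22 1 (- p / r) 0 (1 / r)" "mat22 1 p 0 r"])
        (simp_all add: a mat22_one field_simps)
  next
    case 2
    then show thesis
      by (intro that[of "mat22 (- s / q) 1 (1 / q) 0" "mat22 0 q 1 s"])
        (simp_all add: a mat22_one field_simps)
  next
    case 3
    then have "s - p \<noteq> 0" by simp
    with 3 show thesis
      by (intro that[of "mat22 (s / (s - p)) (- p / (s - p)) (- 1 / (s - p)) (1 / (s - p))"
            "mat22 1 p 1 s"])
        (simp_all add: a mat22_one divide_simps, simp_all add: algebra_simps)
  qed
qed

text \<open>The companion matrix depends only on trace and determinant, so both matrices are similar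
  to the same one.\<close>

lemma similar_nonscalar:
  fixes a b :: "'f::field m2"
  assumes "\<not> (a$1$2 = 0 \<and> a$2$1 = 0 \<and> a$1$1 = a$2$2)"
    and "\<not> (b$1$2 = 0 \<and> b$2$1 = 0 \<and> b$1$1 = b$2$2)"
    and "a$1$1 + a$2$2 = b$1$1 + b$2$2"
    and "a$1$1 * a$2$2 - a$1$2 * a$2$1 = b$1$1 * b$2$2 - b$1$2 * b$2$1"
  obtains P Q where "P ** Q = mat 1" "Q ** P = mat 1" "P ** a ** Q = b"
proof -
  obtain P Q where PQ: "P ** Q = mat 1" "Q ** P = mat 1"
    "P ** a ** Q = mat22 0 (a$1$2 * a$2$1 - a$1$1 * a$2$2) 1 (a$1$1 + a$2$2)"
    using similar_companion[OF assms(1)] .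
  obtain P' Q' where PQ': "P' ** Q' = mat 1" "Q' ** P' = mat 1"
    "P' ** b ** Q' = mat22 0 (b$1$2 * b$2$1 - b$1$1 * b$2$2) 1 (b$1$1 + b$2$2)"
    using similar_companion[OF assms(2)] .
  have "a$1$2 * a$2$1 - a$1$1 * a$2$2 = b$1$2 * b$2$1 - b$1$1 * b$2$2"
    using assms(4) by (simp add: algebra_simps)
  then have eq: "P ** a ** Q = P' ** b ** Q'"
    using PQ(3) PQ'(3) assms(3) by simp
  show thesis
  proof (rule that)
    show "Q' ** P ** (Q ** P') = mat 1" "Q ** P' ** (Q' ** P) = mat 1"
      using PQ PQ' by (metis matrix_mul_assoc matrix_mul_lid)+
    have "Q' ** P ** a ** (Q ** P') = Q' ** (P ** a ** Q) ** P'"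
      by (simp add: matrix_mul_assoc)
    also have "\<dots> = b"
      unfolding eq using PQ' by (metis matrix_mul_assoc matrix_mul_lid matrix_mul_rid)
    finally show "Q' ** P ** a ** (Q ** P') = b" .
  qed
qed

subsection \<open>Classification\<close>

text \<open>Comparing the identity for the pairs 1, x and x, 1 shows that \<open>R\<close> scales
  e12 to b e12 and maps e21 to c' e21. The pair e12, e21 then leaves two choices of b and c', which
  transposition exchanges.\<close>

lemma RB_M1_cases:
  fixes R :: "'f::field_char_0 m2 \<Rightarrow> 'f m2"
  assumes rb: "is_RB1 R" and one: "R (mat 1) = mat22 0 0 0 1"
  shows "R = RB_M1 \<or> conj_transpose R = RB_M1"
proof -
  note add = RB1_add[OF rb] and scl = RB1_mscale[OF rb] and mult = RB1_mult[OF rb]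
    and zero = RB1_zero[OF rb]
  \<comment> \<open>The pair 1, 1 gives 2 R e22 = 0, and 2 is invertible in characteristic
    zero.\<close>
  have E22: "R (mat22 0 0 0 1) = 0"
    using mult[of "mat 1" "mat 1"] by (simp add: one m2_eq_iff)
  have E11: "R (mat22 1 0 0 0) = mat22 0 0 0 1"
    using add[of "mat22 1 0 0 0" "mat22 0 0 0 1"] one by (simp add: E22 mat22_one)
  obtain a b c d where E12: "R (mat22 0 1 0 0) = mat22 a b c d" by (rule mat22_cases)
  have E12_left: "R (mat22 a b c d) + mat22 a b c d = mat22 0 0 c d"
    using mult[of "mat 1" "mat22 0 1 0 0"] by (simp add: one E12 flip: mat22_zero) (simp add: zero)
  have E12_right: "R (mat22 a b c d) + mat22 a b c d + mat22 a b c d = mat22 0 b 0 d"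
    using mult[of "mat22 0 1 0 0" "mat 1"] by (simp add: one E12)
  \<comment> \<open>Eliminating R u for u = R e12 leaves u = u e22 - e22 u, which holds only for
    multiples of e12.\<close>
  have "mat22 0 0 c d + mat22 a b c d = mat22 0 b 0 d"
    using E12_left E12_right by simp
  then have u: "a = 0" "c = 0" "d = 0" by simp_all
  obtain a' b' c' d' where E21: "R (mat22 0 0 1 0) = mat22 a' b' c' d'" by (rule mat22_cases)
  have E21_left: "R (mat22 a' b' c' d') + mat22 a' b' c' d' + mat22 a' b' c' d' = mat22 0 0 c' d'"
    using mult[of "mat 1" "mat22 0 0 1 0"] by (simp add: one E21)
  have E21_right: "R (mat22 a' b' c' d') + mat22 a' b' c' d' = mat22 0 b' 0 d'"
    using mult[of "mat22 0 0 1 0" "mat 1"] by (simp add: one E21 flip: mat22_zero) (simp add: zero)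
  have "mat22 0 b' 0 d' + mat22 a' b' c' d' = mat22 0 0 c' d'"
    using E21_left E21_right by simp
  then have v: "a' = 0" "b' = 0" "d' = 0" by simp_all
  have "R (mat22 (c' + b + 1) 0 0 0) = mscale (c' + b + 1) (mat22 0 0 0 1)"
    using scl[of "c' + b + 1" "mat22 1 0 0 0"] by (simp add: E11)
  \<comment> \<open>The left side is b c' e11, the right side (c' + b + 1) e22.\<close>
  then have bc: "b * c' = 0" "c' + b + 1 = 0"
    using mult[of "mat22 0 1 0 0" "mat22 0 0 1 0"] unfolding add[symmetric]
    by (simp_all add: E12 E21 u v algebra_simps)
  then consider "b = - 1" "c' = 0" | "b = 0" "c' = - 1"
    by (auto simp: add_eq_0_iff2)
  then show ?thesis
  proof cases
    case 1
    then have "R = RB_M1"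
      by (intro ext, subst RB1_expand[OF rb])
        (simp add: E11 E12 E21 E22 u v RB_M1_def m2_eq_iff)
    then show ?thesis ..
  next
    case 2
    then have "conj_transpose R = RB_M1"
      by (intro ext, unfold conj_transpose_def comp_def, subst RB1_expand[OF rb])
        (simp add: E11 E12 E21 E22 u v RB_M1_def m2_eq_iff)
    then show ?thesis ..
  qed
qed

text \<open>The scheme is that of \<open>RB_M1_cases\<close>. Here R e11 is a multiple of e11
  itself, so the pair e12, e21 yields one relation only, and the pair e21, e12 supplies the
  other.\<close>

lemma RB_M2_cases:
  fixes R :: "'f::field_char_0 m2 \<Rightarrow> 'f m2"
  assumes rb: "is_RB1 R" and one: "R (mat 1) = mat22 (- 1) 0 0 0"
  shows "R = RB_M2 \<or> conj_transpose R = RB_M2"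
proof -
  note add = RB1_add[OF rb] and scl = RB1_mscale[OF rb] and mult = RB1_mult[OF rb]
    and zero = RB1_zero[OF rb] and minus = RB1_minus[OF rb]
  have "R (mat22 (- 1) 0 0 0) = mat22 1 0 0 0"
    using mult[of "mat 1" "mat 1"] by (simp add: one m2_eq_iff)
  then have E11: "R (mat22 1 0 0 0) = mat22 (- 1) 0 0 0"
    using minus[of "mat22 (- 1) 0 0 0"] by simp
  have E22: "R (mat22 0 0 0 1) = 0"
    using add[of "mat22 1 0 0 0" "mat22 0 0 0 1"] one by (simp add: E11 mat22_one)
  obtain a b c d where E12: "R (mat22 0 1 0 0) = mat22 a b c d" by (rule mat22_cases)
  have "R (mat22 0 (- 1) 0 0) = - mat22 a b c d"
    using minus[of "mat22 0 1 0 0"] by (simp add: E12)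
  then have E12_left: "R (mat22 a b c d) = - mat22 a b 0 0"
    using mult[of "mat 1" "mat22 0 1 0 0"] by (simp add: one E12) (simp add: m2_eq_iff)
  have E12_right: "R (mat22 a b c d) + mat22 a b c d = - mat22 a 0 c 0"
    using mult[of "mat22 0 1 0 0" "mat 1"] by (simp add: one E12 flip: mat22_zero) (simp add: zero)
  have "- mat22 a b 0 0 + mat22 a b c d = - mat22 a 0 c 0"
    using E12_left E12_right by simp
  then have u: "a = 0" "c = 0" "d = 0" by (simp_all add: eq_neg_iff_add_eq_0)
  obtain a' b' c' d' where E21: "R (mat22 0 0 1 0) = mat22 a' b' c' d'" by (rule mat22_cases)
  have "R (mat22 0 0 (- 1) 0) = - mat22 a' b' c' d'"
    using minus[of "mat22 0 0 1 0"] by (simp add: E21)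
  then have E21_right: "R (mat22 a' b' c' d') = - mat22 a' 0 c' 0"
    using mult[of "mat22 0 0 1 0" "mat 1"] by (simp add: one E21) (simp add: m2_eq_iff)
  have E21_left: "R (mat22 a' b' c' d') + mat22 a' b' c' d' = - mat22 a' b' 0 0"
    using mult[of "mat 1" "mat22 0 0 1 0"] by (simp add: one E21 flip: mat22_zero) (simp add: zero)
  have "- mat22 a' 0 c' 0 + mat22 a' b' c' d' = - mat22 a' b' 0 0"
    using E21_left E21_right by simp
  then have v: "a' = 0" "b' = 0" "d' = 0" by (simp_all add: eq_neg_iff_add_eq_0)
  have "R (mat22 (c' + b + 1) 0 0 0) = mscale (c' + b + 1) (mat22 (- 1) 0 0 0)"
    using scl[of "c' + b + 1" "mat22 1 0 0 0"] by (simp add: E11)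
  then have bc1: "b * c' = - (c' + b + 1)"
    using mult[of "mat22 0 1 0 0" "mat22 0 0 1 0"] unfolding add[symmetric]
    by (simp add: E12 E21 u v algebra_simps)
  have "R (mat22 0 0 0 (b + c' + 1)) = 0"
    using scl[of "b + c' + 1" "mat22 0 0 0 1"] by (simp add: E22 m2_eq_iff)
  then have bc2: "b * c' = 0"
    using mult[of "mat22 0 0 1 0" "mat22 0 1 0 0"] unfolding add[symmetric]
    by (simp add: E12 E21 u v mat22_zero algebra_simps)
  have "c' + b + 1 = 0"
    using bc1 bc2 by (metis neg_equal_0_iff_equal)
  with bc2 consider "b = - 1" "c' = 0" | "b = 0" "c' = - 1"
    by (auto simp: add_eq_0_iff2)
  then show ?thesis
  proof cases
    case 1
    then have "R = RB_M2"
      by (intro ext, subst RB1_expand[OF rb])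
        (simp add: E11 E12 E21 E22 u v RB_M2_def m2_eq_iff)
    then show ?thesis ..
  next
    case 2
    then have "conj_transpose R = RB_M2"
      by (intro ext, unfold conj_transpose_def comp_def, subst RB1_expand[OF rb])
        (simp add: E11 E12 E21 E22 u v RB_M2_def m2_eq_iff)
    then show ?thesis ..
  qed
qed

text \<open>By Cayley--Hamilton, the identity for the pair 1, a with a = R 1 becomes a linear
  relation between a and 1, whose coefficients must vanish. Discriminant 1 means that the
  eigenvalues differ by 1; the other clause leaves the spectra {0, 1}, {0, - 1} and {- 1, -
  2}.\<close>

lemma RB1_one_nonscalar:
  fixes R :: "'f::field_char_0 m2 \<Rightarrow> 'f m2"
  assumes rb: "is_RB1 R" and a: "R (mat 1) = mat22 p q r s" and ns: "\<not> (q = 0 \<and> r = 0 \<and> p = s)"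
  shows "(p + s)^2 - 4 * (p * s - q * r) = 1 \<and> (p * s = q * r \<or> p + s = - 3)"
proof -
  note add = RB1_add[OF rb] and scl = RB1_mscale[OF rb] and mult = RB1_mult[OF rb]
  define a where "a = mat22 p q r s"
  define \<tau> where "\<tau> = p + s"
  define \<delta> where "\<delta> = p * s - q * r"
  have aa: "a ** a = mscale \<tau> a + mscale (- \<delta>) (mat 1)"
    by (simp add: a_def \<tau>_def \<delta>_def m2_eq_iff algebra_simps)
  have Ra: "mscale 2 (R a) = a ** a + mscale (- 1) a"
    using mult[of "mat 1" "mat 1"] by (simp add: a[folded a_def] m2_eq_iff algebra_simps)
  have Raa: "R (a ** a) = mscale \<tau> (R a) + mscale (- \<delta>) a"
    by (simp add: aa add scl a[folded a_def])
  have "mscale 2 (R (R a)) = R (mscale 2 (R a))"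
    by (simp add: scl)
  then have RRa: "mscale 2 (R (R a)) = R (a ** a) + mscale (- 1) (R a)"
    unfolding Ra by (simp add: add scl)
  have "a ** R a = R (a ** a) + R (R a) + R a"
    using mult[of "mat 1" a] by (simp add: a[folded a_def])
  \<comment> \<open>The factor 4 avoids halves, because only 2 R a and 2 R (R a) are known.\<close>
  then have "mscale 4 (a ** R a) = mscale 4 (R (a ** a)) + mscale 2 (mscale 2 (R (R a))) + mscale 4 (R a)"
    by (simp add: m2_eq_iff algebra_simps)
  then have "mscale 4 (a ** R a) = mscale 6 (R (a ** a)) + mscale 2 (R a)"
    unfolding RRa by (simp add: m2_eq_iff algebra_simps)
  then have "mscale 2 (a ** mscale 2 (R a)) =
      mscale (3 * \<tau> + 1) (mscale 2 (R a)) + mscale (- 6 * \<delta>) a"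
    unfolding Raa by (simp add: m2_eq_iff algebra_simps)
  then have "mscale 2 (a ** (a ** a + mscale (- 1) a)) =
      mscale (3 * \<tau> + 1) (a ** a + mscale (- 1) a) + mscale (- 6 * \<delta>) a"
    by (simp only: Ra)
  also have "a ** (a ** a + mscale (- 1) a) = mscale (\<tau> - 1) (a ** a) + mscale (- \<delta>) a"
  proof -
    have "a ** (mscale \<tau> a + mscale (- \<delta>) (mat 1)) = mscale \<tau> (a ** a) + mscale (- \<delta>) a"
      by (simp add: m2_eq_iff algebra_simps)
    then have "a ** (a ** a) = mscale \<tau> (a ** a) + mscale (- \<delta>) a"
      by (simp only: aa[symmetric])
    moreover have "a ** (a ** a + mscale (- 1) a) = a ** (a ** a) + mscale (- 1) (a ** a)"
      by (simp add: m2_eq_iff algebra_simps)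
    ultimately show ?thesis
      by (simp add: m2_eq_iff algebra_simps)
  qed
  finally have "mscale (1 + 4 * \<delta> - \<tau>^2) a + mscale (\<delta> * (\<tau> + 3)) (mat 1) = 0"
    unfolding aa by (simp add: m2_eq_iff algebra_simps power2_eq_square)
  then have eqs: "(1 + 4 * \<delta> - \<tau>^2) * p + \<delta> * (\<tau> + 3) = 0" "(1 + 4 * \<delta> - \<tau>^2) * q = 0"
    "(1 + 4 * \<delta> - \<tau>^2) * r = 0" "(1 + 4 * \<delta> - \<tau>^2) * s + \<delta> * (\<tau> + 3) = 0"
    by (simp_all add: a_def m2_eq_iff)
  \<comment> \<open>Together with the off-diagonal equations this makes the coefficient of a vanish,
    as a is not scalar.\<close>
  have "(1 + 4 * \<delta> - \<tau>^2) * (p - s) = 0"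
  proof -
    have "(1 + 4 * \<delta> - \<tau>^2) * (p - s) =
        ((1 + 4 * \<delta> - \<tau>^2) * p + \<delta> * (\<tau> + 3)) - ((1 + 4 * \<delta> - \<tau>^2) * s + \<delta> * (\<tau> + 3))"
      by (simp add: algebra_simps)
    then show ?thesis by (simp only: eqs) simp
  qed
  then have "1 + 4 * \<delta> - \<tau>^2 = 0"
    using eqs(2,3) ns by auto
  moreover from this have d: "\<delta> * (\<tau> + 3) = 0"
    using eqs(1) by simp
  moreover from d have "\<delta> = 0 \<or> \<tau> = - 3"
    by (simp add: eq_neg_iff_add_eq_0)
  ultimately have "\<tau>^2 - 4 * \<delta> = 1 \<and> (\<delta> = 0 \<or> \<tau> = - 3)"
    by (simp add: algebra_simps)
  then show ?thesis
    by (simp add: \<tau>_def \<delta>_def)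
qed

text \<open>Since \<open>rb_phi\<close> replaces a = R 1 by - (a + 1), it maps the spectrum {- 1, -
  2} to {0, 1} and the scalar - 1 to 0. Only operators that vanish at 1 remain; the assumption
  \<open>zero\<close> mentions just \<open>R\<close> and \<open>rb_phi R\<close>, so that
  nontriviality can later exclude the zero operator.\<close>

lemma RB1_one_cases:
  fixes R :: "'f::field_char_0 m2 \<Rightarrow> 'f m2"
  assumes rb: "is_RB1 R"
    and zero: "\<And>S. \<lbrakk>is_RB1 S; S = R \<or> S = rb_phi R; S (mat 1) = 0\<rbrakk> \<Longrightarrow> RB_listed S"
  shows "RB_listed R"
proof -
  obtain p q r s where a: "R (mat 1) = mat22 p q r s" by (rule mat22_cases)
  have phi: "is_RB1 (rb_phi R)" "rb_phi R (mat 1) = mat22 (- (p + 1)) (- q) (- r) (- (s + 1))"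
    using is_RB1_rb_phi[OF rb] by (simp_all add: rb_phi_def a[unfolded mat22_one] mat22_one)
  have listed1: "RB_listed S" if "is_RB1 S" "S (mat 1) = mat22 0 0 0 1" for S :: "'f m2 \<Rightarrow> 'f m2"
    using RB_M1_cases[OF that] RB_listedI[of RB_M1] RB_listed_transpose[of S]
    by (auto simp: RB_list_def)
  have listed2: "RB_listed S" if "is_RB1 S" "S (mat 1) = mat22 (- 1) 0 0 0" for S :: "'f m2 \<Rightarrow> 'f m2"
    using RB_M2_cases[OF that] RB_listedI[of RB_M2] RB_listed_transpose[of S]
    by (auto simp: RB_list_def)
  have listed1': "RB_listed S" if S: "is_RB1 S" "S (mat 1) = mat22 p q r s"
    and ns: "\<not> (q = 0 \<and> r = 0 \<and> p = s)" "p + s = 1" "p * s = q * r"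
    for S :: "'f m2 \<Rightarrow> 'f m2" and p q r s
  proof -
    obtain P Q where PQ: "P ** Q = mat 1" "Q ** P = mat 1" "P ** mat22 p q r s ** Q = mat22 0 0 0 1"
      using ns by (rule_tac similar_nonscalar[of "mat22 p q r s" "mat22 0 0 0 1"]) auto
    have "RB_listed (conj_mat P Q S)"
      using is_RB1_conj_mat[OF PQ(1,2) S(1)] conj_mat_one[OF PQ(1,2), of S] PQ(3) S(2)
      by (intro listed1) simp_all
    then show ?thesis using RB_listed_conj_mat PQ by blast
  qed
  show ?thesis
  proof (cases "q = 0 \<and> r = 0 \<and> p = s")
    case True
    then have "R (mat 1) = mscale p (mat 1)"
      by (simp add: a m2_eq_iff)
    then have "mscale p (mat 1) ** mscale p (mat 1) =
        mscale p (mscale p (mat 1)) + mscale p (mscale p (mat 1)) + mscale p (mat 1 :: 'f m2)"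
      using RB1_mult[OF rb, of "mat 1" "mat 1"] by (simp add: RB1_mscale[OF rb])
    then have "p * (p + 1) = 0"
      by (simp add: m2_eq_iff algebra_simps)
    then consider "p = 0" | "p = - 1"
      by (auto simp: add_eq_0_iff2)
    then show ?thesis
    proof cases
      case 1
      then show ?thesis using True a zero[OF rb] by (simp add: mat22_zero)
    next
      case 2
      then have "rb_phi R (mat 1) = 0"
        unfolding phi(2) using True by (simp add: mat22_zero)
      then show ?thesis using RB_listed_phi zero[OF phi(1)] by blast
    qed
  next
    case False
    then have disc: "(p + s)^2 - 4 * (p * s - q * r) = 1" and "p * s = q * r \<or> p + s = - 3"
      using RB1_one_nonscalar[OF rb a] by auto
    moreover have "p * s - q * r = 2" if "p + s = - 3"
    proof -
      have "4 * (p * s - q * r) = (p + s)^2 - 1"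
        using disc by (simp add: algebra_simps)
      then have "4 * (p * s - q * r) = 4 * 2"
        unfolding that by simp
      then show ?thesis by (simp only: mult_cancel_left) simp
    qed
    \<comment> \<open>The spectra are {0, 1}, {0, - 1} and {- 1, - 2}, in this order.\<close>
    ultimately consider "p * s = q * r" "p + s = 1" | "p * s = q * r" "p + s = - 1"
      | "p * s - q * r = 2" "p + s = - 3"
      by (auto simp: power2_eq_1_iff)
    then show ?thesis
    proof cases
      case 1
      then show ?thesis using listed1'[OF rb a] False by blast
    next
      case 2
      obtain P Q where PQ: "P ** Q = mat 1" "Q ** P = mat 1"
        "P ** mat22 p q r s ** Q = mat22 (- 1) 0 0 0"
        using 2 False by (rule_tac similar_nonscalar[of "mat22 p q r s" "mat22 (- 1) 0 0 0"]) auto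
      have "RB_listed (conj_mat P Q R)"
        using is_RB1_conj_mat[OF PQ(1,2) rb] conj_mat_one[OF PQ(1,2), of R] PQ(3) a
        by (intro listed2) simp_all
      then show ?thesis using RB_listed_conj_mat PQ by blast
    next
      case 3
      \<comment> \<open>The matrix - (a + 1) has eigenvalues 0 and 1, hence trace 1 and determinant
        0.\<close>
      have "RB_listed (rb_phi R)"
      proof (rule listed1'[OF phi])
        show "\<not> (- q = 0 \<and> - r = 0 \<and> - (p + 1) = - (s + 1))"
          using False by auto
        have "- (p + 1) + - (s + 1) = - (p + s) - 2" by simp
        then show "- (p + 1) + - (s + 1) = 1" by (simp only: 3(2)) simp
        have "- (p + 1) * - (s + 1) - - q * - r = (p * s - q * r) + (p + s) + 1"
          by (simp add: algebra_simps)
        then have "- (p + 1) * - (s + 1) - - q * - r = 0" by (simp only: 3) simp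
        then show "- (p + 1) * - (s + 1) = - q * - r" by simp
      qed
      then show ?thesis by (rule RB_listed_phi)
    qed
  qed
qed

section \<open>Operators that vanish at the identity\<close>

text \<open>This is the identity for the pair x, 1. So - R is a projection, and \<open>R\<close> is
  - 1 on its image.\<close>

lemma RB1_one_zero_idem:
  assumes "is_RB1 R" "R (mat 1) = 0"
  shows "R (R x) = - R x"
proof -
  have "0 = R (R x) + R x"
    using RB1_mult[OF assms(1), of x "mat 1"] RB1_zero[OF assms(1)] assms(2)
    by (simp add: matrix_mul_rid)
  then show ?thesis by (metis eq_neg_iff_add_eq_0)
qed

text \<open>For u in the image, u u is in the image too, so R (u u) = - u u. Cayley--Hamilton and R
  1 = 0 give R (u u) = - \<tau> u instead, and the difference is \<delta> times the
  identity.\<close>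

lemma RB1_one_zero_singular:
  fixes R :: "'f::field m2 \<Rightarrow> 'f m2"
  assumes rb: "is_RB1 R" and one: "R (mat 1) = 0"
  shows "R x $ 1 $ 1 * R x $ 2 $ 2 = R x $ 1 $ 2 * R x $ 2 $ 1"
proof -
  define u where "u = R x"
  define \<tau> where "\<tau> = u$1$1 + u$2$2"
  define \<delta> where "\<delta> = u$1$1 * u$2$2 - u$1$2 * u$2$1"
  have uu: "u ** u = mscale \<tau> u + mscale (- \<delta>) (mat 1)"
    by (simp add: \<tau>_def \<delta>_def m2_eq_iff algebra_simps)
  have Ru: "R u = - u"
    unfolding u_def by (rule RB1_one_zero_idem[OF rb one])
  have "R (u ** u) = - (u ** u)"
    using RB1_mult[OF rb, of x x] RB1_one_zero_idem[OF rb one]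
    by (metis RB1_add[OF rb] u_def)
  moreover have "R (u ** u) = mscale (- \<tau>) u"
    unfolding uu by (simp add: RB1_add[OF rb] RB1_mscale[OF rb] Ru one m2_eq_iff)
  ultimately have "\<delta> = 0"
    unfolding uu by (simp add: m2_eq_iff)
  then show ?thesis
    by (simp add: \<delta>_def u_def)
qed

section \<open>The explicit families conjugate to (M3)--(M6)\<close>

lemma RB_list_listed:
  "RB_listed RB_M3" "RB_listed RB_M4" "RB_listed RB_M5" "RB_listed RB_M6"
  by (auto intro!: RB_listedI simp: RB_list_def)

text \<open>The kernel is spanned by 1 and \<open>mat22 c d 1 0\<close>, and q is a quarter of the
  discriminant of that matrix. If q = 0 the operator is conjugate to (M6); otherwise a square root
  of q, which exists by algebraic closedness, diagonalises the kernel and gives (M5).\<close>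

lemma RB_M6_family_listed:
  fixes R :: "'f::{alg_closed_field, field_char_0} m2 \<Rightarrow> 'f m2"
  assumes R: "R = (\<lambda>x. mat22 (x$2$2 - x$1$1 + c * x$2$1) (d * x$2$1 - x$1$2) 0 0)"
  shows "RB_listed R"
proof -
  define q where "q = d + c\<^sup>2 / 4"
  define S where "S = (\<lambda>x :: 'f m2. mat22 (x$2$2 - x$1$1) (q * x$2$1 - x$1$2) 0 0)"
  \<comment> \<open>This shear completes the square: modulo scalars it takes
    \<open>mat22 c d 1 0\<close> to \<open>mat22 0 q 1 0\<close>.\<close>
  have PQ: "mat22 1 (- c / 2) 0 1 ** mat22 1 (c / 2) 0 1 = mat 1"
    "mat22 1 (c / 2) 0 1 ** mat22 1 (- c / 2) 0 1 = mat 1"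
    by (simp_all add: mat22_one)
  have "conj_mat (mat22 1 (- c / 2) 0 1) (mat22 1 (c / 2) 0 1) R = S"
    by (simp add: fun_eq_iff conj_mat_def R S_def q_def m2_eq_iff power2_eq_square field_simps)
  moreover have "RB_listed S"
  proof (cases "q = 0")
    case True
    then have "S = RB_M6" by (simp add: S_def RB_M6_def fun_eq_iff)
    then show ?thesis by (simp add: RB_list_listed)
  next
    case False
    obtain r where r: "r * r = q"
      using nth_root_exists[of 2 q] by (auto simp: power2_eq_square)
    with False have r0: "r \<noteq> 0" by auto
    text \<open>The columns of Q are eigenvectors of the matrix that spans the kernel together with 1.\<close>
    define P where "P = mat22 (1 / (2 * r)) (1 / 2) (- 1 / (2 * r)) (1 / 2)"
    define Q where "Q = mat22 r (- r) 1 1"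
    have PQ: "P ** Q = mat 1" "Q ** P = mat 1"
      using r0 by (simp_all add: P_def Q_def mat22_one)
    have "conj_transpose (conj_mat P Q S) = RB_M5"
      using r0 by (simp add: fun_eq_iff conj_transpose_def conj_mat_def S_def P_def Q_def RB_M5_def
          m2_eq_iff field_simps flip: r)
    then show ?thesis
      using RB_listed_conj_mat[OF PQ] RB_listed_transpose RB_list_listed(3) by metis
  qed
  ultimately show ?thesis
    using RB_listed_conj_mat[OF PQ] by metis
qed

text \<open>The functional is x -> tr (N x) with N = \<open>mat22 (- 1) c b 1\<close>, which has
  trace 0 and, by \<open>bc\<close>, determinant 0. A basis of kernel vectors of N and of e11 gives
  (M4).\<close>

lemma RB_M4_family_listed:
  fixes R :: "'f::field m2 \<Rightarrow> 'f m2"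
  assumes R: "R = (\<lambda>x. mat22 (x$2$2 - x$1$1 + b * x$1$2 + c * x$2$1) 0 0 0)" and bc: "b * c = - 1"
  shows "RB_listed R"
proof -
  have c: "c \<noteq> 0"
    using bc by auto
  then have b: "b = - 1 / c"
    using bc by (subst nonzero_eq_divide_eq) simp_all
  text \<open>The first column of Q spans the kernel of the nilpotent N with R x = tr (N x) e11.\<close>
  define P where "P = mat22 (1 / c) 0 (- 1 / c) 1"
  define Q where "Q = mat22 c 0 1 1"
  have PQ: "P ** Q = mat 1" "Q ** P = mat 1"
    using c by (simp_all add: P_def Q_def mat22_one)
  have "conj_mat P Q R = RB_M4"
    using c by (simp add: fun_eq_iff conj_mat_def P_def Q_def R b RB_M4_def m2_eq_iff field_simps)
  then show ?thesis
    using RB_listed_conj_mat[OF PQ] RB_list_listed by metis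
qed

text \<open>The shear fixes e12 and turns the functional in the upper right entry into - x12;
  transposition then yields (M3).\<close>

lemma RB_M3_family_listed:
  fixes R :: "'f::field m2 \<Rightarrow> 'f m2"
  assumes R: "R = (\<lambda>x. mat22 0 (a * (x$1$1 - x$2$2) - x$1$2 + a\<^sup>2 * x$2$1) 0 0)"
  shows "RB_listed R"
proof -
  have PQ: "mat22 1 a 0 1 ** mat22 1 (- a) 0 1 = mat 1" "mat22 1 (- a) 0 1 ** mat22 1 a 0 1 = mat 1"
    by (simp_all add: mat22_one)
  have "conj_transpose (conj_mat (mat22 1 a 0 1) (mat22 1 (- a) 0 1) R) = RB_M3"
    by (simp add: fun_eq_iff conj_transpose_def conj_mat_def R RB_M3_def m2_eq_iff
        power2_eq_square algebra_simps)
  then show ?thesis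
    using RB_listed_conj_mat[OF PQ] RB_listed_transpose RB_list_listed(1) by metis
qed

text \<open>As - R is a projection into the first row, its image is the whole row or, because of
  \<open>unit\<close>, the line of e11 or of e12. Each possibility leads to one of the
  families.\<close>

lemma RB1_first_row_listed:
  fixes R :: "'f::{alg_closed_field, field_char_0} m2 \<Rightarrow> 'f m2"
  assumes rb: "is_RB1 R" and one: "R (mat 1) = 0"
    and row: "\<And>x. R x $ 2 $ 1 = 0 \<and> R x $ 2 $ 2 = 0"
    and unit: "R (mat22 1 0 0 0) = - mat22 1 0 0 0 \<or> R (mat22 0 1 0 0) = - mat22 0 1 0 0"
  shows "RB_listed R"
proof -
  obtain a a' where E11: "R (mat22 1 0 0 0) = mat22 a a' 0 0"
    using row[of "mat22 1 0 0 0"] by (metis mat22_cases mat22_sel(3,4))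
  obtain b b' where E12: "R (mat22 0 1 0 0) = mat22 b b' 0 0"
    using row[of "mat22 0 1 0 0"] by (metis mat22_cases mat22_sel(3,4))
  obtain c c' where E21: "R (mat22 0 0 1 0) = mat22 c c' 0 0"
    using row[of "mat22 0 0 1 0"] by (metis mat22_cases mat22_sel(3,4))
  have "R (mat22 1 0 0 0) + R (mat22 0 0 0 1) = 0"
    using one by (simp add: mat22_one flip: RB1_add[OF rb])
  then have E22: "R (mat22 0 0 0 1) = mat22 (- a) (- a') 0 0"
    unfolding E11 by (metis add_eq_0_iff mat22_simps(3) neg_equal_0_iff_equal)
  have R: "R x = mat22 (a * (x$1$1 - x$2$2) + b * x$1$2 + c * x$2$1)
      (a' * (x$1$1 - x$2$2) + b' * x$1$2 + c' * x$2$1) 0 0" for x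
    by (subst RB1_expand[OF rb]) (simp add: E11 E12 E21 E22 algebra_simps)
  note idem = RB1_one_zero_idem[OF rb one]
  have i1: "a * a + a' * b = - a" "a * a' + a' * b' = - a'"
    using idem[of "mat22 1 0 0 0"] by (simp_all add: R algebra_simps)
  have i2: "a * b + b * b' = - b" "b * a' + b' * b' = - b'"
    using idem[of "mat22 0 1 0 0"] by (simp_all add: R algebra_simps)
  have i3: "a * c + b * c' = - c" "c * a' + c' * b' = - c'"
    using idem[of "mat22 0 0 1 0"] by (simp_all add: R algebra_simps)
  \<comment> \<open>The cases are: image the whole row, the line of e11, the line of e12.\<close>
  consider "a = - 1" "a' = 0" "b = 0" "b' = - 1"
    | "a = - 1" "a' = 0" "b' = 0" "c' = 0" | "a = 0" "b = 0" "b' = - 1" "c = 0"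
  proof -
    from unit consider "a = - 1" "a' = 0" | "b = 0" "b' = - 1"
      by (auto simp: E11 E12)
    then show thesis
    proof cases
      case 1
      then have "b * b' = 0" "b' * (b' + 1) = 0" "c' * (b' + 1) = 0"
        using i2 i3 by (simp_all add: algebra_simps)
      then show thesis
        using 1 that(1,2) by (auto simp: add_eq_0_iff2)
    next
      case 2
      then have "a * a' = 0" "a * (a + 1) = 0" "c * (a + 1) = 0"
        using i1 i3 by (simp_all add: algebra_simps)
      then show thesis
        using 2 that(1,3) by (auto simp: add_eq_0_iff2)
    qed
  qed
  then show ?thesis
  proof cases
    case 1
    then show ?thesis
      by (intro RB_M6_family_listed[of R c c']) (simp add: fun_eq_iff R)
  next
    case 2
    \<comment> \<open>The projection property leaves b and c free; the product of R e12 and R e21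
      relates them.\<close>
    have "b * c = - 1"
      using RB1_mult[OF rb, of "mat22 0 1 0 0" "mat22 0 0 1 0"] by (simp add: R 2)
    with 2 show ?thesis
      by (intro RB_M4_family_listed[of R b c]) (simp_all add: fun_eq_iff R)
  next
    case 3
    have "c' = a'\<^sup>2"
      using RB1_mult[OF rb, of "mat22 1 0 0 0" "mat22 0 0 1 0"]
      by (simp add: R 3 power2_eq_square mat22_zero)
    with 3 show ?thesis
      by (intro RB_M3_family_listed[of R a']) (simp add: fun_eq_iff R)
  qed
qed

text \<open>Both u and u - e11 are singular for every u in the image, which forces u22 = 0 and then
  u12 u21 = 0.\<close>

lemma RB1_E11_listed:
  fixes R :: "'f::{alg_closed_field, field_char_0} m2 \<Rightarrow> 'f m2"
  assumes rb: "is_RB1 R" and one: "R (mat 1) = 0" and E11: "R (mat22 1 0 0 0) = - mat22 1 0 0 0"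
  shows "RB_listed R"
proof -
  have sing: "R x $ 2 $ 2 = 0 \<and> R x $ 1 $ 2 * R x $ 2 $ 1 = 0" for x
  proof -
    have e: "R (x + mat22 1 0 0 0) = R x - mat22 1 0 0 0"
      by (simp add: RB1_add[OF rb] E11 m2_eq_iff)
    then show ?thesis
      using RB1_one_zero_singular[OF rb one, of x]
        RB1_one_zero_singular[OF rb one, of "x + mat22 1 0 0 0", unfolded e]
      by (simp add: algebra_simps)
  qed
  \<comment> \<open>A vector space is not the union of two proper subspaces.\<close>
  have "(\<forall>x. R x $ 1 $ 2 = 0) \<or> (\<forall>x. R x $ 2 $ 1 = 0)"
  proof (rule ccontr)
    assume "\<not> ?thesis"
    then obtain x y where "R x $ 1 $ 2 \<noteq> 0" "R y $ 2 $ 1 \<noteq> 0" by auto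
    moreover have "(R x $ 1 $ 2 + R y $ 1 $ 2) * (R x $ 2 $ 1 + R y $ 2 $ 1) = 0"
      using sing[of "x + y"] by (simp add: RB1_add[OF rb])
    ultimately show False
      using sing[of x] sing[of y] by auto
  qed
  then show ?thesis
  proof
    assume "\<forall>x. R x $ 2 $ 1 = 0"
    then show ?thesis
      using sing E11 by (intro RB1_first_row_listed[OF rb one]) auto
  next
    assume "\<forall>x. R x $ 1 $ 2 = 0"
    then have "RB_listed (conj_transpose R)"
      using sing E11
      by (intro RB1_first_row_listed is_RB1_conj_transpose rb)
        (auto simp: conj_transpose_def one mat22_zero mat22_one[symmetric])
    then show ?thesis by (rule RB_listed_transpose)
  qed
qed

text \<open>Singularity of u and u - e12 makes every u in the image upper triangular with a zero on
  the diagonal, and linearity puts that zero always in the same place.\<close>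

lemma RB1_E12_listed:
  fixes R :: "'f::{alg_closed_field, field_char_0} m2 \<Rightarrow> 'f m2"
  assumes rb: "is_RB1 R" and one: "R (mat 1) = 0" and E12: "R (mat22 0 1 0 0) = - mat22 0 1 0 0"
  shows "RB_listed R"
proof -
  have sing: "R x $ 2 $ 1 = 0 \<and> R x $ 1 $ 1 * R x $ 2 $ 2 = 0" for x
  proof -
    have e: "R (x + mat22 0 1 0 0) = R x - mat22 0 1 0 0"
      by (simp add: RB1_add[OF rb] E12 m2_eq_iff)
    then show ?thesis
      using RB1_one_zero_singular[OF rb one, of x]
        RB1_one_zero_singular[OF rb one, of "x + mat22 0 1 0 0", unfolded e]
      by (simp add: algebra_simps)
  qed
  have "(\<forall>x. R x $ 1 $ 1 = 0) \<or> (\<forall>x. R x $ 2 $ 2 = 0)"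
  proof (rule ccontr)
    assume "\<not> ?thesis"
    then obtain x y where "R x $ 1 $ 1 \<noteq> 0" "R y $ 2 $ 2 \<noteq> 0" by auto
    moreover have "(R x $ 1 $ 1 + R y $ 1 $ 1) * (R x $ 2 $ 2 + R y $ 2 $ 2) = 0"
      using sing[of "x + y"] by (simp add: RB1_add[OF rb])
    ultimately show False
      using sing[of x] sing[of y] by auto
  qed
  then show ?thesis
  proof
    assume "\<forall>x. R x $ 2 $ 2 = 0"
    then show ?thesis
      using sing E12 by (intro RB1_first_row_listed[OF rb one]) auto
  next
    assume *: "\<forall>x. R x $ 1 $ 1 = 0"
    \<comment> \<open>Transposition combined with the swap \<open>J\<close> reflects in the
      antidiagonal: it fixes e12 and moves the second column to the first row.\<close>
    define J :: "'f m2" where "J = mat22 0 1 1 0"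
    have J: "J ** J = mat 1"
      by (simp add: J_def mat22_one)
    define S where "S = conj_transpose (conj_mat J J R)"
    have "RB_listed S"
    proof (rule RB1_first_row_listed)
      show "is_RB1 S"
        unfolding S_def by (intro is_RB1_conj_transpose is_RB1_conj_mat J rb)
      show "S (mat 1) = 0"
        by (simp add: S_def conj_transpose_def conj_mat_one[OF J J] one m2_eq_iff)
      show "S x $ 2 $ 1 = 0 \<and> S x $ 2 $ 2 = 0" for x
        using * sing by (simp add: S_def conj_transpose_def conj_mat_def J_def)
      show "S (mat22 1 0 0 0) = - mat22 1 0 0 0 \<or> S (mat22 0 1 0 0) = - mat22 0 1 0 0"
        by (simp add: S_def conj_transpose_def conj_mat_def J_def E12)
    qed
    then show ?thesis
      unfolding S_def by (metis RB_listed_transpose RB_listed_conj_mat J)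
  qed
qed

text \<open>A nonzero element of the image is singular. With trace 0 it is nilpotent and similar to
  e12; otherwise a multiple of it is idempotent and similar to e11.\<close>

lemma RB1_one_zero_listed:
  fixes R :: "'f::{alg_closed_field, field_char_0} m2 \<Rightarrow> 'f m2"
  assumes rb: "is_RB1 R" and one: "R (mat 1) = 0" and "R \<noteq> (\<lambda>x. 0)"
  shows "RB_listed R"
proof -
  obtain x where x: "R x \<noteq> 0" using assms(3) by auto
  define u where "u = R x"
  have u0: "u \<noteq> 0" and Ru: "R u = - u"
    using x RB1_one_zero_idem[OF rb one] by (simp_all add: u_def)
  have det: "u$1$1 * u$2$2 = u$1$2 * u$2$1"
    unfolding u_def by (rule RB1_one_zero_singular[OF rb one])
  have ns: "\<not> (u$1$2 = 0 \<and> u$2$1 = 0 \<and> u$1$1 = u$2$2)"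
    using det u0 by (auto simp: m2_eq_iff)
  show ?thesis
  proof (cases "u$1$1 + u$2$2 = 0")
    case True
    obtain P Q where PQ: "P ** Q = mat 1" "Q ** P = mat 1" "P ** u ** Q = mat22 0 1 0 0"
      using ns det True by (rule_tac similar_nonscalar[of u "mat22 0 1 0 0"]) auto
    have "RB_listed (conj_mat P Q R)"
    proof (rule RB1_E12_listed)
      show "is_RB1 (conj_mat P Q R)" "conj_mat P Q R (mat 1) = 0"
        using is_RB1_conj_mat[OF PQ(1,2) rb] conj_mat_one[OF PQ(1,2), of R] one by simp_all
      show "conj_mat P Q R (mat22 0 1 0 0) = - mat22 0 1 0 0"
        unfolding PQ(3)[symmetric] conj_mat_apply[OF PQ(1,2)] Ru by (simp add: m2_eq_iff algebra_simps)
    qed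
    then show ?thesis using RB_listed_conj_mat PQ by blast
  next
    case False
    \<comment> \<open>Rescaled to trace 1, with determinant still 0.\<close>
    define v where "v = mscale (1 / (u$1$1 + u$2$2)) u"
    have Rv: "R v = - v"
      by (simp add: v_def RB1_mscale[OF rb] Ru m2_eq_iff)
    obtain P Q where PQ: "P ** Q = mat 1" "Q ** P = mat 1" "P ** v ** Q = mat22 1 0 0 0"
    proof (rule similar_nonscalar[of v "mat22 1 0 0 0"])
      show "\<not> (v$1$2 = 0 \<and> v$2$1 = 0 \<and> v$1$1 = v$2$2)"
        using ns False by (simp add: v_def)
      show "v$1$1 + v$2$2 = mat22 1 0 0 0 $1$1 + mat22 1 0 0 0 $2$2"
        using False by (simp add: v_def flip: add_divide_distrib)
    qed (use det in \<open>simp_all add: v_def\<close>)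
    have "RB_listed (conj_mat P Q R)"
    proof (rule RB1_E11_listed)
      show "is_RB1 (conj_mat P Q R)" "conj_mat P Q R (mat 1) = 0"
        using is_RB1_conj_mat[OF PQ(1,2) rb] conj_mat_one[OF PQ(1,2), of R] one by simp_all
      show "conj_mat P Q R (mat22 1 0 0 0) = - mat22 1 0 0 0"
        unfolding PQ(3)[symmetric] conj_mat_apply[OF PQ(1,2)] Rv by (simp add: m2_eq_iff algebra_simps)
    qed
    then show ?thesis using RB_listed_conj_mat PQ by blast
  qed
qed

subsection \<open>Orbit invariants\<close>

lemma rb_generators_cases [consumes 1, case_names phi transpose conj]:
  assumes "g \<in> rb_generators"
  obtains "g = rb_phi" | "g = conj_transpose"
    | \<psi> where "algebra_automorphism mscale (**) \<psi>" "g = conj_by \<psi>"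
  using assms by (auto simp: rb_generators_def)

lemma is_RB1_generator: "\<lbrakk>g \<in> rb_generators; is_RB1 R\<rbrakk> \<Longrightarrow> is_RB1 (g R)"
  by (erule rb_generators_cases) (auto intro: is_RB1_rb_phi is_RB1_conj_transpose is_RB1_conj_by)

lemma algebra_automorphism_one:
  assumes "algebra_automorphism mscale (**) (\<psi> :: 'f::field m2 \<Rightarrow> 'f m2)"
  shows "\<psi> (mat 1) = mat 1"
proof -
  have "surj \<psi>" and mult: "\<psi> (x ** y) = \<psi> x ** \<psi> y" for x y
    using assms by (auto simp: algebra_automorphism_def bij_is_surj)
  then obtain x where x: "\<psi> x = mat 1" by (metis surjD)
  show ?thesis
    using mult[of "mat 1" x] by (simp add: x)
qed

lemma algebra_automorphism_zero:
  assumes "algebra_automorphism mscale (**) (\<psi> :: 'f::field m2 \<Rightarrow> 'f m2)"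
  shows "\<psi> x = 0 \<longleftrightarrow> x = 0"
proof -
  have "inj \<psi>" and add: "\<psi> (x + y) = \<psi> x + \<psi> y" for x y
    using assms by (auto simp: algebra_automorphism_def linear_mscale_iff bij_is_inj)
  have "\<psi> 0 = 0"
    using add[of 0 0] by simp
  then show ?thesis
    using inj_eq[OF \<open>inj \<psi>\<close>, of x 0] by simp
qed

text \<open>The separate variable S keeps this usable as a rule: X (g R) would not be a higher-order pattern.\<close>

definition rb_invariant :: "(('f::field m2 \<Rightarrow> 'f m2) \<Rightarrow> bool) \<Rightarrow> bool" where
  "rb_invariant X \<longleftrightarrow> (\<forall>g \<in> rb_generators. \<forall>R S. X R \<longrightarrow> S = g R \<longrightarrow> X S)"

lemma rb_orbit_neq:
  assumes "rb_invariant X" "X S" "\<not> X T"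
  shows "rb_orbit T \<noteq> rb_orbit S"
proof
  assume "rb_orbit T = rb_orbit S"
  then have "T \<in> rb_orbit S"
    using rb_orbit_refl[of T] by simp
  then have "X T"
    by (rule rb_orbit_invariant[where X = X]) (use assms in \<open>simp_all add: rb_invariant_def\<close>)
  with assms(3) show False ..
qed

text \<open>It says that - R is a projection; \<open>rb_phi\<close> passes to the complementary
  projection. \<open>is_RB1\<close> is included to have linearity at hand.\<close>

definition idem_RB1 :: "('f::field m2 \<Rightarrow> 'f m2) \<Rightarrow> bool" where
  "idem_RB1 R \<longleftrightarrow> is_RB1 R \<and> (\<forall>x. R (R x) = - R x)"

text \<open>The map phi exchanges the eigenvalues c and - 1 - c, which is why an eigenvalue only makes
  sense relative to the value of the operator at the identity matrix.\<close>

definition unital_eigen :: "'f \<Rightarrow> ('f m2 \<Rightarrow> bool) \<Rightarrow> ('f::field m2 \<Rightarrow> 'f m2) \<Rightarrow> bool" where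
  "unital_eigen c C R \<longleftrightarrow> is_RB1 R \<and>
     (\<exists>x. C x \<and> (R (mat 1) = 0 \<and> R x = mscale c x \<or>
                R (mat 1) = - mat 1 \<and> R x = mscale (- 1 - c) x))"

lemma rb_invariant_idem_RB1: "rb_invariant (idem_RB1 :: ('f::field m2 \<Rightarrow> 'f m2) \<Rightarrow> bool)"
  unfolding rb_invariant_def
proof (intro ballI allI impI)
  fix g :: "('f m2 \<Rightarrow> 'f m2) \<Rightarrow> 'f m2 \<Rightarrow> 'f m2" and R S :: "'f m2 \<Rightarrow> 'f m2"
  assume g: "g \<in> rb_generators" and R: "idem_RB1 R" and S: "S = g R"
  have rb: "is_RB1 R" and idem: "R (R x) = - R x" for x
    using R by (auto simp: idem_RB1_def)
  have "g R (g R x) = - g R x" for x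
    using g
  proof (cases rule: rb_generators_cases)
    case phi
    then show ?thesis
      by (simp add: rb_phi_def RB1_minus[OF rb] RB1_add[OF rb] idem flip: minus_add_distrib)
  next
    case transpose
    then show ?thesis
      by (simp add: conj_transpose_def idem) (simp add: m2_eq_iff)
  next
    case (conj \<psi>)
    have "\<psi> (inv_into UNIV \<psi> y) = y" for y
      using conj(1) by (simp add: algebra_automorphism_def bij_is_surj surj_f_inv_f)
    moreover have "inv_into UNIV \<psi> (- y) = - inv_into UNIV \<psi> y" for y
    proof -
      have "inv_into UNIV \<psi> (mscale (- 1) y) = mscale (- 1) (inv_into UNIV \<psi> y)"
        using algebra_automorphism_inv[OF conj(1)]
        by (simp add: algebra_automorphism_def linear_mscale_iff)
      moreover have "mscale (- 1) z = - z" for z :: "'f m2"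
        by (simp add: m2_eq_iff)
      ultimately show ?thesis by simp
    qed
    ultimately show ?thesis
      by (simp add: conj(2) conj_by_def idem)
  qed
  then show "idem_RB1 S"
    using S is_RB1_generator[of g R] g rb by (simp add: idem_RB1_def)
qed

text \<open>The eigenvector moves along with the operator: it stays x under \<open>rb_phi\<close>,
  which swaps the two alternatives, and becomes \<open>transpose x\<close> or the preimage of x
  under \<psi> in the other cases.\<close>

lemma rb_invariant_unital_eigen:
  fixes C :: "'f::field m2 \<Rightarrow> bool"
  assumes transpose: "\<And>x. C x \<Longrightarrow> C (transpose x)"
    and automorphism: "\<And>\<psi> x. \<lbrakk>algebra_automorphism mscale (**) \<psi>; C x\<rbrakk> \<Longrightarrow> C (\<psi> x)"
  shows "rb_invariant (unital_eigen c C)"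
  unfolding rb_invariant_def
proof (intro ballI allI impI)
  fix g :: "('f m2 \<Rightarrow> 'f m2) \<Rightarrow> 'f m2 \<Rightarrow> 'f m2" and R S :: "'f m2 \<Rightarrow> 'f m2"
  assume g: "g \<in> rb_generators" and R: "unital_eigen c C R" and S: "S = g R"
  obtain x where x: "C x" and alt: "R (mat 1) = 0 \<and> R x = mscale c x \<or>
      R (mat 1) = - mat 1 \<and> R x = mscale (- 1 - c) x"
    using R by (auto simp: unital_eigen_def)
  have "\<exists>y. C y \<and> (g R (mat 1) = 0 \<and> g R y = mscale c y \<or>
      g R (mat 1) = - mat 1 \<and> g R y = mscale (- 1 - c) y)"
    using g
  proof (cases rule: rb_generators_cases)
    case phi
    have "- (mscale c x + x) = mscale (- 1 - c) x" "- (mscale (- 1 - c) x + x) = mscale c x"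
      by (simp_all add: m2_eq_iff algebra_simps)
    with alt show ?thesis
      by (intro exI[of _ x]) (auto simp: phi rb_phi_def x)
  next
    case transpose
    have "transpose (mscale d x) = mscale d (transpose x)" for d
      by (simp add: m2_eq_iff)
    moreover have "transpose (- mat 1 :: 'f m2) = - mat 1" "transpose (0 :: 'f m2) = 0"
      by (simp_all add: m2_eq_iff)
    ultimately show ?thesis
      using alt by (intro exI[of _ "transpose x"])
        (auto simp: transpose conj_transpose_def x assms(1))
  next
    case (conj \<psi>)
    let ?i = "inv_into UNIV \<psi>"
    have i: "algebra_automorphism mscale (**) ?i"
      by (rule algebra_automorphism_inv[OF conj(1)])
    then have scl: "?i (mscale d y) = mscale d (?i y)" for d y
      by (simp add: algebra_automorphism_def linear_mscale_iff)
    have "mscale (- 1) y = - y" "mscale 0 y = 0" for y :: "'f m2"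
      by (simp_all add: m2_eq_iff)
    then have "?i (- mat 1) = - mat 1" "?i 0 = 0"
      using scl[of "- 1" "mat 1"] scl[of 0 0] algebra_automorphism_one[OF i] by simp_all
    moreover have "\<psi> (?i x) = x"
      using conj(1) by (simp add: algebra_automorphism_def bij_is_surj surj_f_inv_f)
    ultimately show ?thesis
      using alt by (intro exI[of _ "?i x"])
        (auto simp: conj(2) conj_by_def x scl automorphism[OF i]
          algebra_automorphism_one[OF conj(1)])
  qed
  then show "unital_eigen c C S"
    using S R is_RB1_generator[of g R] g by (simp add: unital_eigen_def)
qed

text \<open>At x = 0 the eigenvalue equation is vacuous, so this invariant only records that R 1 is
  0 or - 1.\<close>

lemma rb_invariant_unital_eigen_zero:
  "rb_invariant (unital_eigen c (\<lambda>x :: 'f::field m2. x = 0))"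
proof (rule rb_invariant_unital_eigen)
  show "transpose x = 0" if "x = 0" for x :: "'f m2"
    using that by (simp add: m2_eq_iff)
  show "\<psi> x = 0" if "algebra_automorphism mscale (**) \<psi>" "x = 0" for \<psi> and x :: "'f m2"
    using that(2) algebra_automorphism_zero[OF that(1), of x] by simp
qed

text \<open>The case d = 0 detects nonzero nilpotents of square zero in an eigenspace, d = 1 nonzero
  idempotents.\<close>

lemma rb_invariant_unital_eigen_square:
  "rb_invariant (unital_eigen c (\<lambda>x :: 'f::field m2. x \<noteq> 0 \<and> x ** x = mscale d x))"
proof (rule rb_invariant_unital_eigen)
  show "transpose x \<noteq> 0 \<and> transpose x ** transpose x = mscale d (transpose x)"
    if "x \<noteq> 0 \<and> x ** x = mscale d x" for x :: "'f m2"
    using that by (simp add: m2_eq_iff algebra_simps)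
  show "\<psi> x \<noteq> 0 \<and> \<psi> x ** \<psi> x = mscale d (\<psi> x)"
    if "algebra_automorphism mscale (**) \<psi>" "x \<noteq> 0 \<and> x ** x = mscale d x"
    for \<psi> and x :: "'f m2"
  proof -
    have "\<psi> x ** \<psi> x = \<psi> (x ** x)" "\<psi> (mscale d x) = mscale d (\<psi> x)"
      using that(1) by (simp_all add: algebra_automorphism_def linear_mscale_iff)
    then show ?thesis
      using that by (simp add: algebra_automorphism_zero[OF that(1)])
  qed
qed

section \<open>Separation of the six orbits\<close>

lemma unital_eigenI:
  "\<lbrakk>is_RB1 R; C x; R (mat 1) = 0; R x = mscale c x\<rbrakk> \<Longrightarrow> unital_eigen c C R"
  unfolding unital_eigen_def by (intro conjI exI[of _ x]) simp_all

lemmas RB_M_defs = RB_M1_def RB_M2_def RB_M3_def RB_M4_def RB_M5_def RB_M6_def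

text \<open>Each invariant splits one operator off from those that remain, in the order (M1), (M2),
  (M5), (M4), and finally (M3) from (M6).\<close>

lemma distinct_orbits:
  "distinct (map rb_orbit (RB_list :: ('f::field m2 \<Rightarrow> 'f m2) list))"
proof -
  let ?M1 = "RB_M1 :: 'f m2 \<Rightarrow> 'f m2"
  let ?M2 = "RB_M2 :: 'f m2 \<Rightarrow> 'f m2"
  let ?M3 = "RB_M3 :: 'f m2 \<Rightarrow> 'f m2"
  let ?M4 = "RB_M4 :: 'f m2 \<Rightarrow> 'f m2"
  let ?M5 = "RB_M5 :: 'f m2 \<Rightarrow> 'f m2"
  let ?M6 = "RB_M6 :: 'f m2 \<Rightarrow> 'f m2"
  have rb: "is_RB1 ?M2" "is_RB1 ?M3" "is_RB1 ?M4" "is_RB1 ?M5"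
    "is_RB1 ?M6"
    using RB_list_RB1[where 'f = 'f] by (simp_all add: RB_list_def)
  let ?zero = "\<lambda>x :: 'f m2. x = 0"
  let ?nil = "\<lambda>x :: 'f m2. x \<noteq> 0 \<and> x ** x = mscale 0 x"
  let ?idem = "\<lambda>x :: 'f m2. x \<noteq> 0 \<and> x ** x = mscale 1 x"
  \<comment> \<open>\<open>RB_M1\<close> takes 1 to e22 and e22 to 0, so it is not - 1 on its
    image.\<close>
  have "\<not> idem_RB1 ?M1"
  proof -
    have "?M1 (?M1 (mat 1)) \<noteq> - ?M1 (mat 1 :: 'f m2)"
      by (simp add: RB_M1_def)
    then show ?thesis by (auto simp: idem_RB1_def)
  qed
  moreover have "idem_RB1 ?M2" "idem_RB1 ?M3" "idem_RB1 ?M4" "idem_RB1 ?M5"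
    "idem_RB1 ?M6"
    by (auto simp: idem_RB1_def rb) (simp_all add: RB_M_defs)
  ultimately have M1: "rb_orbit ?M1 \<noteq> rb_orbit M"
    if "M \<in> {?M2, ?M3, ?M4, ?M5, ?M6}" for M
    using that rb_orbit_neq[OF rb_invariant_idem_RB1, of M ?M1] by blast
  have one: "?M3 (mat 1) = 0" "?M4 (mat 1) = 0" "?M5 (mat 1) = 0"
    "?M6 (mat 1 :: 'f m2) = 0"
    by (simp_all add: RB_M_defs mat22_zero)
  \<comment> \<open>The value at 1 is - e11, which is not scalar.\<close>
  have "\<not> unital_eigen 0 ?zero ?M2"
    by (simp add: unital_eigen_def RB_M2_def m2_eq_iff)
  moreover have "unital_eigen 0 ?zero M" if "M \<in> {?M3, ?M4, ?M5, ?M6}" for M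
    using that rb one by (intro unital_eigenI[of _ _ 0]) (auto simp: RB1_zero m2_eq_iff)
  ultimately have M2: "rb_orbit ?M2 \<noteq> rb_orbit M"
    if "M \<in> {?M3, ?M4, ?M5, ?M6}" for M
    using that rb_orbit_neq[OF rb_invariant_unital_eigen_zero, of 0 M ?M2] by blast
  \<comment> \<open>The kernel of \<open>RB_M5\<close> consists of the diagonal matrices.\<close>
  have "\<not> unital_eigen 0 ?nil ?M5"
  proof -
    have "\<not> ?nil x" if "?M5 x = mscale 0 x" for x
      using that by (auto simp: RB_M5_def m2_eq_iff)
    moreover have "?M5 (mat 1) \<noteq> - mat 1"
      unfolding one by (simp add: m2_eq_iff)
    ultimately show ?thesis
      unfolding unital_eigen_def by blast
  qed
  moreover have "unital_eigen 0 ?nil ?M3" "unital_eigen 0 ?nil ?M4"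
    by (rule unital_eigenI[of _ _ "mat22 0 1 0 0"]; simp add: rb one RB_M_defs mat22_zero)+
  moreover have "unital_eigen 0 ?nil ?M6"
    by (rule unital_eigenI[of _ _ "mat22 0 0 1 0"]; simp add: rb one RB_M_defs mat22_zero)
  ultimately have M5: "rb_orbit ?M5 \<noteq> rb_orbit M"
    if "M \<in> {?M3, ?M4, ?M6}" for M
    using that rb_orbit_neq[OF rb_invariant_unital_eigen_square, of 0 0 M ?M5] by blast
  \<comment> \<open>The eigenspace for - 1 is spanned by the idempotent e11 - e21.\<close>
  have "\<not> unital_eigen (- 1) ?nil ?M4"
  proof -
    have "\<not> ?nil x" if "?M4 x = mscale (- 1) x" for x
      using that by (auto simp: RB_M4_def m2_eq_iff)
    moreover have "?M4 (mat 1) \<noteq> - mat 1"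
      unfolding one by (simp add: m2_eq_iff)
    ultimately show ?thesis
      unfolding unital_eigen_def by blast
  qed
  moreover have "unital_eigen (- 1) ?nil ?M3"
    by (rule unital_eigenI[of _ _ "mat22 0 0 1 0"]; simp add: rb one RB_M_defs mat22_zero)
  moreover have "unital_eigen (- 1) ?nil ?M6"
    by (rule unital_eigenI[of _ _ "mat22 0 1 0 0"]; simp add: rb one RB_M_defs mat22_zero)
  ultimately have M4: "rb_orbit ?M4 \<noteq> rb_orbit M"
    if "M \<in> {?M3, ?M6}" for M
    using that rb_orbit_neq[OF rb_invariant_unital_eigen_square, of "- 1" 0 M ?M4] by blast
  \<comment> \<open>The eigenspace for - 1 is spanned by the nilpotent e21, whereas that of
    \<open>RB_M6\<close> contains e11.\<close>
  have "\<not> unital_eigen (- 1) ?idem ?M3"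
  proof -
    have "\<not> ?idem x" if "?M3 x = mscale (- 1) x" for x
      using that by (auto simp: RB_M3_def m2_eq_iff)
    moreover have "?M3 (mat 1) \<noteq> - mat 1"
      unfolding one by (simp add: m2_eq_iff)
    ultimately show ?thesis
      unfolding unital_eigen_def by blast
  qed
  moreover have "unital_eigen (- 1) ?idem ?M6"
    by (rule unital_eigenI[of _ _ "mat22 1 0 0 0"]; simp add: rb one RB_M_defs mat22_zero)
  ultimately have M3: "rb_orbit ?M3 \<noteq> rb_orbit ?M6"
    using rb_orbit_neq[OF rb_invariant_unital_eigen_square, of "- 1" 1 ?M6 ?M3] by blast
  show ?thesis
    using M1 M2 M3 M4 M5 M4[THEN not_sym] M5[THEN not_sym] by (simp add: RB_list_def)
qed

theorem corollary1:
  shows "(\<forall>R :: 'f::{alg_closed_field, field_char_0} m2 \<Rightarrow> 'f m2.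
            nontrivial_RB1 R \<longrightarrow> (\<exists>M \<in> set RB_list. M \<in> rb_orbit R)) \<and>
         (\<forall>M \<in> set (RB_list :: ('f m2 \<Rightarrow> 'f m2) list). is_RB1 M) \<and>
         distinct (map rb_orbit (RB_list :: ('f m2 \<Rightarrow> 'f m2) list))"
proof (intro conjI allI impI)
  fix R :: "'f m2 \<Rightarrow> 'f m2"
  assume "nontrivial_RB1 R"
  then have rb: "is_RB1 R" and R: "R \<noteq> (\<lambda>x. 0)" "R \<noteq> (\<lambda>x. - x)"
    by (simp_all add: nontrivial_RB1_def)
  \<comment> \<open>Being different from - id is what nontriviality of \<open>R\<close> means for
    \<open>rb_phi R\<close>; so neither operator to which \<open>RB1_one_zero_listed\<close> may be
    applied is zero.\<close>
  have phi: "rb_phi R \<noteq> (\<lambda>x. 0)"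
  proof
    assume "rb_phi R = (\<lambda>x. 0)"
    then have "R x + x = 0" for x
      by (simp only: rb_phi_def fun_eq_iff neg_equal_0_iff_equal)
    then have "R = (\<lambda>x. - x)"
      by (simp add: fun_eq_iff eq_neg_iff_add_eq_0)
    with R(2) show False ..
  qed
  have "RB_listed R"
    using rb
  proof (rule RB1_one_cases)
    fix S
    assume "is_RB1 S" "S = R \<or> S = rb_phi R" "S (mat 1) = 0"
    then show "RB_listed S"
      using R(1) phi by (intro RB1_one_zero_listed) auto
  qed
  then show "\<exists>M \<in> set RB_list. M \<in> rb_orbit R"
    by (simp only: RB_listed_def)
qed (use RB_list_RB1 distinct_orbits in \<open>simp_all\<close>)

end
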